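(* Let $K \subsetneq \mathbb{R}^m$ be a pointed closed convex cone with nonempty interior, let $F \colon \mathbb{R}^n \rightrightarrows \mathbb{R}^m$ be a set-valued mapping with closed graph, and let $\Omega$ be an unbounded closed subset of $\mathbb{R}^n$. Let $\overline{y} \in \mathrm{cl}\, F(\Omega) \setminus F(\Omega)$ be a weak efficient value for the problem $$\mathrm{minimize}_{K} \ F (x) \quad \text{subject to } x \in \Omega,$$ and suppose that the following constraint qualification at infinity is satisfied: $$D^*F(\infty, \overline{y})(0) \cap \big(-N_{\Omega}(\infty)\big) = \{0\}.$$ Then there exists a vector $c^* \in K^{+} \setminus \{0\}$ such that $$0 \in D^*F(\infty, \overline{y}) (c^* ) + N_{\Omega}(\infty).$$
   Context: All spaces $\mathbb{R}^n$ carry the Euclidean inner product and norm. $\mathrm{gph}\,F := \{(x,y) : y\in F(x)\}$, $F(\Omega):=\bigcup_{x\in\Omega}F(x)$, and $\mathrm{cl}$ denotes closure. The positive polar of $K$ is $K^{+} := \{ c^{*} \in \mathbb{R}^m : \langle c^{*}, y \rangle \geq 0 \text{ for all } y \in K \}$. Weak efficient value: $\overline{y} \in \mathrm{cl}\, F(\Omega)$ is a weak efficient value for the problem if $(\overline{y} - \mathrm{int}\, K)\cap F(\Omega) = \emptyset$. Regular normal cone: for $C\subset\mathbb{R}^N$ and $z\in C$, $\widehat{N}_C(z)$ is the set of $\xi\in\mathbb{R}^N$ with $\langle \xi, z'-z\rangle\le o(\|z'-z\|)$ as $z'\to z$, $z'\in C$. Normal cones at infinity: $N_\Omega(\infty)$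 is the set of all $\xi\in\mathbb{R}^n$ for which there exist $x_k\in\Omega$ with $\|x_k\|\to\infty$ and $\xi_k\in\widehat{N}_\Omega(x_k)$ with $\xi_k\to\xi$. For $C\subset\mathbb{R}^n\times\mathbb{R}^m$ and $\overline{y}\in\mathbb{R}^m$, $N_C(\infty,\overline{y})$ is the set of all $\xi$ for which there exist $(x_k,y_k)\in C$ with $\|x_k\|\to\infty$, $y_k\to\overline{y}$, and $\xi_k\in\widehat{N}_C(x_k,y_k)$ with $\xi_k\to\xi$. Coderivative at infinity: $D^*F(\infty,\overline{y})(v) := \{u\in\mathbb{R}^n : (u,-v)\in N_{\mathrm{gph}\,F}(\infty,\overline{y})\}$, $v\in\mathbb{R}^m$. *)

theory Defs
  imports
    "HOL-Analysis.Analysis"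
    "HOL-Library.Landau_Symbols"
    "HOL-Library.Set_Algebras"
begin

definition gph :: "('a \<Rightarrow> 'b set) \<Rightarrow> ('a \<times> 'b) set" where
  "gph F = {(x, y). y \<in> F x}"

definition set_valued_image :: "('a \<Rightarrow> 'b set) \<Rightarrow> 'a set \<Rightarrow> 'b set" where
  "set_valued_image F \<Omega> = (\<Union>x\<in>\<Omega>. F x)"

definition pointed :: "'a::real_vector set \<Rightarrow> bool" where
  "pointed K \<longleftrightarrow> K \<inter> uminus ` K = {0}"

definition positive_polar :: "'a::real_inner set \<Rightarrow> 'a set" where
  "positive_polar K = {c. \<forall>y\<in>K. c \<bullet> y \<ge> 0}"

definition weak_efficient_value ::
    "'b::real_normed_vector set \<Rightarrow> ('a \<Rightarrow> 'b set) \<Rightarrow> 'a set \<Rightarrow> 'b \<Rightarrow> bool" where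
  "weak_efficient_value K F \<Omega> y \<longleftrightarrow>
     y \<in> closure (set_valued_image F \<Omega>) \<and>
     ((\<lambda>k. y - k) ` interior K) \<inter> set_valued_image F \<Omega> = {}"

text \<open>
  The term \<open>o(\<parallel>z' - z\<parallel>)\<close> in the upper bound is an actual function \<open>r\<close>. The filter
  leaves out \<open>z' = z\<close>, where both sides vanish. The definition is meaningful for \<open>z \<in> C\<close>
  only, and it is used below only for such points.
\<close>
definition regular_normal_cone :: "'a::real_inner set \<Rightarrow> 'a \<Rightarrow> 'a set" where
  "regular_normal_cone C z =
     {\<xi>. \<exists>r \<in> o[at z within C](\<lambda>z'. norm (z' - z)).
           \<forall>\<^sub>F z' in at z within C. \<xi> \<bullet> (z' - z) \<le> r z'}"

definition normal_cone_at_infinity :: "'a::real_inner set \<Rightarrow> 'a set" where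
  "normal_cone_at_infinity \<Omega> =
     {\<xi>. \<exists>x \<xi>s. (\<forall>k::nat. x k \<in> \<Omega>) \<and>
             filterlim (\<lambda>k. norm (x k)) at_top sequentially \<and>
             (\<forall>k. \<xi>s k \<in> regular_normal_cone \<Omega> (x k)) \<and>
             \<xi>s \<longlonglongrightarrow> \<xi>}"

definition normal_cone_at_infinity_value ::
    "('a::real_inner \<times> 'b::real_inner) set \<Rightarrow> 'b \<Rightarrow> ('a \<times> 'b) set" where
  "normal_cone_at_infinity_value C ybar =
     {\<xi>. \<exists>x y \<xi>s. (\<forall>k::nat. (x k, y k) \<in> C) \<and>
             filterlim (\<lambda>k. norm (x k)) at_top sequentially \<and>
             y \<longlonglongrightarrow> ybar \<and>
             (\<forall>k. \<xi>s k \<in> regular_normal_cone C (x k, y k)) \<and>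
             \<xi>s \<longlonglongrightarrow> \<xi>}"

definition coderivative_at_infinity ::
    "('a::real_inner \<Rightarrow> 'b::real_inner set) \<Rightarrow> 'b \<Rightarrow> 'b \<Rightarrow> 'a set" where
  "coderivative_at_infinity F ybar v =
     {u. (u, - v) \<in> normal_cone_at_infinity_value (gph F) ybar}"

end

theory Submission
  imports Defs
begin

text \<open>
  A vector \<open>c\<^sup>*\<close> as required is a limit of approximate multipliers, found at points of \<open>gph F\<close>
  and \<open>\<Omega>\<close> that run off to infinity while the values tend to \<open>ybar\<close>. Such points are available
  because \<open>ybar\<close> is approached by \<open>F\<close> on \<open>\<Omega>\<close> but not attained: by compactness, values close to
  \<open>ybar\<close> are taken only far away (\<open>far_points_near_unattained_value\<close>).

  To find multipliers near such a point \<open>(x0, y0)\<close>, shift \<open>ybar\<close> slightly to \<open>ybar - e\<close> with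
  \<open>e \<in> interior K\<close>, and let \<open>Q\<close> be \<open>ybar - e - K\<close>. Since \<open>e + K \<subseteq> interior K\<close>, weak efficiency
  says that \<open>F\<close> on \<open>\<Omega>\<close> never meets \<open>Q\<close>, while \<open>y0\<close> is very close to \<open>Q\<close>; so \<open>(x0, y0)\<close> almost
  minimizes the distance of the value to \<open>Q\<close>. The constraint \<open>x \<in> \<Omega>\<close> is decoupled from the graph
  by a copy \<open>x' \<in> \<Omega>\<close> of \<open>x\<close> and a penalty, and one minimizes
  \<open>d(y, Q) + \<parallel>(x, y) - (x0, y0)\<parallel>\<^sup>2 + j \<parallel>x - x'\<parallel>\<^sup>2\<close> over \<open>(x, y) \<in> gph F\<close> and \<open>x' \<in> \<Omega>\<close>. In finite
  dimension a minimizer exists, and the middle term keeps it near \<open>(x0, y0)\<close>; this term takes the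
  place of a variational principle. For large \<open>j\<close> the minimizer still has \<open>y \<notin> Q\<close>
  (\<open>penalized_min_positive\<close>), hence the distance is smooth there, its gradient \<open>c\<close> is a
  unit vector, and \<open>c \<in> K\<^sup>+\<close> because \<open>Q\<close> is a translate of \<open>-K\<close>. With \<open>p = 2 j (x - x')\<close> the first order conditions are
  \<open>p \<in> N(x')\<close> and, up to a small error, \<open>(-p, -c) \<in> N(x, y)\<close>, where the regular normal cones are those of
  \<open>\<Omega>\<close> and \<open>gph F\<close> (\<open>penalized_min_normals\<close>, \<open>approximate_multipliers\<close>).

  The vectors \<open>p\<close> may be unbounded. Scaling both relations by \<open>t = 1 / (1 + \<parallel>p\<parallel>)\<close> makes everything
  converge along a subsequence. If \<open>t\<close> tends to \<open>0\<close>, then \<open>t p\<close> has a limit of norm \<open>1\<close>, whose negative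
  is a nonzero element of the intersection excluded by the constraint qualification. Otherwise the limit of
  \<open>t c\<close> is the required \<open>c\<^sup>*\<close>.
\<close>

section \<open>Regular normals\<close>

text \<open>
  Every normal below comes from comparing a minimum with other points, where the error terms are
  explicit quadratics.
\<close>

lemma regular_normal_coneI_quadratic:
  fixes z :: "'a::real_inner"
  assumes "\<And>w. w \<in> C \<Longrightarrow> \<xi> \<bullet> (w - z) \<le> B * (norm (w - z))\<^sup>2"
  shows "\<xi> \<in> regular_normal_cone C z"
proof -
  have "(\<lambda>w. B * (norm (w - z))\<^sup>2) \<in> o[at z within C](\<lambda>w. norm (w - z))"
  proof (rule smalloI_tendsto)
    have "((\<lambda>w. B * norm (w - z)) \<longlongrightarrow> B * norm (z - z)) (at z within C)"
      by (intro tendsto_intros)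
    then have "((\<lambda>w. B * norm (w - z)) \<longlongrightarrow> 0) (at z within C)"
      by simp
    moreover have "\<forall>\<^sub>F w in at z within C. B * norm (w - z) = B * (norm (w - z))\<^sup>2 / norm (w - z)"
      by (simp add: eventually_at_filter power2_eq_square)
    ultimately show "((\<lambda>w. B * (norm (w - z))\<^sup>2 / norm (w - z)) \<longlongrightarrow> 0) (at z within C)"
      by (rule Lim_transform_eventually)
    show "\<forall>\<^sub>F w in at z within C. norm (w - z) \<noteq> 0"
      by (simp add: eventually_at_filter)
  qed
  moreover have "\<forall>\<^sub>F w in at z within C. \<xi> \<bullet> (w - z) \<le> B * (norm (w - z))\<^sup>2"
    using assms by (simp add: eventually_at_filter)
  ultimately show ?thesis
    unfolding regular_normal_cone_def by (intro CollectI bexI)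
qed

lemma regular_normal_cone_scaleR:
  assumes "\<xi> \<in> regular_normal_cone C z" and "0 \<le> t"
  shows "t *\<^sub>R \<xi> \<in> regular_normal_cone C z"
proof -
  obtain r where r: "r \<in> o[at z within C](\<lambda>w. norm (w - z))"
    and le: "\<forall>\<^sub>F w in at z within C. \<xi> \<bullet> (w - z) \<le> r w"
    using assms(1) unfolding regular_normal_cone_def by blast
  have "(\<lambda>w. t * r w) \<in> o[at z within C](\<lambda>w. norm (w - z))"
    using r by (cases "t = 0") auto
  moreover have "\<forall>\<^sub>F w in at z within C. (t *\<^sub>R \<xi>) \<bullet> (w - z) \<le> t * r w"
    using le by eventually_elim (simp add: assms(2) mult_left_mono)
  ultimately show ?thesis
    unfolding regular_normal_cone_def by (intro CollectI bexI)
qed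

section \<open>A penalized minimization\<close>

lemma norm_fst_snd_le: "norm (fst u) \<le> norm u" "norm (snd u) \<le> norm u"
  using norm_fst_le[of "fst u" "snd u"] norm_snd_le[of "snd u" "fst u"] by simp_all

text \<open>
  The weight of the distance to \<open>z0\<close> is \<open>1\<close>: if \<open>f\<close> is at most \<open>s\<^sup>2\<close> at \<open>z0\<close>, the minimizer is within
  \<open>s\<close> of \<open>z0\<close> and the gradient of this term is at most \<open>2 * s\<close> there, so both are small together.
\<close>

definition penalized :: "('b::real_inner \<Rightarrow> real) \<Rightarrow> 'a::real_inner \<times> 'b \<Rightarrow> real \<Rightarrow> 'a \<times> 'b \<Rightarrow> 'a \<Rightarrow> real"
  where "penalized f z0 j z x' = f (snd z) + (norm (z - z0))\<^sup>2 + j * (norm (fst z - x'))\<^sup>2"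

lemma penalized_sublevel:
  assumes "\<And>y. 0 \<le> f y" and "1 \<le> j" and "penalized f z0 j z x' \<le> s\<^sup>2" and "0 \<le> s"
  shows "norm (z - z0) \<le> s" and "norm (fst z - x') \<le> s" and "j * (norm (fst z - x'))\<^sup>2 \<le> s\<^sup>2"
proof -
  have f: "0 \<le> f (snd z)" using assms(1) .
  have j: "0 \<le> j * (norm (fst z - x'))\<^sup>2" using assms(2) by simp
  have "(norm (z - z0))\<^sup>2 \<le> s\<^sup>2"
    using assms(3) f j unfolding penalized_def by linarith
  then show "norm (z - z0) \<le> s" using assms(4) by (rule power2_le_imp_le)
  show *: "j * (norm (fst z - x'))\<^sup>2 \<le> s\<^sup>2"
    using assms(3) f zero_le_power2[of "norm (z - z0)"] unfolding penalized_def by linarith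
  have "1 * (norm (fst z - x'))\<^sup>2 \<le> j * (norm (fst z - x'))\<^sup>2"
    using assms(2) by (intro mult_right_mono) auto
  then have "(norm (fst z - x'))\<^sup>2 \<le> s\<^sup>2" using * by linarith
  then show "norm (fst z - x') \<le> s" using assms(4) by (rule power2_le_imp_le)
qed

lemma penalized_attains_min:
  fixes C :: "('a::euclidean_space \<times> 'b::euclidean_space) set"
  assumes "closed C" and "closed \<Omega>" and "continuous_on UNIV f" and nonneg: "\<And>y. 0 \<le> f y"
    and "1 \<le> j" and z0: "z0 \<in> C" "fst z0 \<in> \<Omega>"
  obtains z x' where "z \<in> C" and "x' \<in> \<Omega>"
    and "\<And>w x''. w \<in> C \<Longrightarrow> x'' \<in> \<Omega> \<Longrightarrow> penalized f z0 j z x' \<le> penalized f z0 j w x''"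
proof -
  define s where "s = sqrt (f (snd z0))"
  have s: "0 \<le> s" "penalized f z0 j z0 (fst z0) = s\<^sup>2"
    using nonneg by (simp_all add: s_def penalized_def)
  let ?S = "(C \<inter> cball z0 s) \<times> (\<Omega> \<inter> cball (fst z0) (2 * s))"
  have "compact ?S"
    using assms(1,2) by (intro compact_Times closed_Int_compact) auto
  moreover have "(z0, fst z0) \<in> ?S" using z0 s by simp
  moreover have "continuous_on ?S (\<lambda>u. penalized f z0 j (fst u) (snd u))"
    unfolding penalized_def
    by (intro continuous_intros continuous_on_compose2[OF assms(3)]) auto
  ultimately have "\<exists>u \<in> ?S. \<forall>v \<in> ?S.
      penalized f z0 j (fst u) (snd u) \<le> penalized f z0 j (fst v) (snd v)"
    by (intro continuous_attains_inf) auto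
  then obtain z x' where zx: "(z, x') \<in> ?S"
    and min: "\<forall>v \<in> ?S. penalized f z0 j z x' \<le> penalized f z0 j (fst v) (snd v)"
    by (metis prod.collapse)
  have "penalized f z0 j z x' \<le> penalized f z0 j w x''" if wx: "w \<in> C" "x'' \<in> \<Omega>" for w x''
  proof (cases "penalized f z0 j w x'' \<le> s\<^sup>2")
    case True
    note near = penalized_sublevel[OF nonneg \<open>1 \<le> j\<close> True s(1)]
    have "norm (fst z0 - fst w) \<le> norm (w - z0)"
      using norm_fst_snd_le(1)[of "w - z0"] by (simp add: norm_minus_commute)
    then have "norm (fst z0 - x'') \<le> 2 * s"
      using near(1,2) norm_triangle_ineq[of "fst z0 - fst w" "fst w - x''"] by simp
    then have "(w, x'') \<in> ?S"
      using wx near(1) by (simp add: dist_norm norm_minus_commute)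
    from bspec[OF min this] show ?thesis by simp
  next
    case False
    have "(z0, fst z0) \<in> ?S" using z0 s by simp
    from bspec[OF min this] show ?thesis using s(2) False by simp
  qed
  then show thesis using zx by (intro that) auto
qed

text \<open>
  For large \<open>j\<close> the positivity of \<open>f\<close> on points of \<open>C\<close> over \<open>\<Omega>\<close> carries over to the minimizer
  \<open>z\<close>, although \<open>fst z\<close> need not lie in \<open>\<Omega>\<close>: if \<open>f\<close> vanished at minimizers for all \<open>j\<close>, then, as the penalty forces
  \<open>fst z - x'\<close> to \<open>0\<close>, a limit point of them would lie over \<open>\<Omega>\<close>, and \<open>f\<close> would vanish there.
\<close>

lemma penalized_min_positive:
  fixes C :: "('a::euclidean_space \<times> 'b::euclidean_space) set"
  assumes C: "closed C" and \<Omega>: "closed \<Omega>" and cont: "continuous_on UNIV f" and nonneg: "\<And>y. 0 \<le> f y"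
    and z0: "z0 \<in> C" "fst z0 \<in> \<Omega>"
    and pos: "\<And>z. z \<in> C \<Longrightarrow> fst z \<in> \<Omega> \<Longrightarrow> 0 < f (snd z)"
  obtains j z x' where "1 \<le> j" and "z \<in> C" and "x' \<in> \<Omega>" and "0 < f (snd z)"
    and "\<And>w x''. w \<in> C \<Longrightarrow> x'' \<in> \<Omega> \<Longrightarrow> penalized f z0 j z x' \<le> penalized f z0 j w x''"
proof (rule ccontr)
  assume neg: "\<not> thesis"
  define s where "s = sqrt (f (snd z0))"
  have s: "0 \<le> s" "\<And>j. penalized f z0 j z0 (fst z0) = s\<^sup>2"
    using nonneg by (simp_all add: s_def penalized_def)
  have "\<exists>z x'. z \<in> C \<and> x' \<in> \<Omega> \<and> f (snd z) = 0 \<and> penalized f z0 (Suc k) z x' \<le> s\<^sup>2" for k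
  proof -
    have "1 \<le> real (Suc k)" by simp
    then obtain z x' where *: "z \<in> C" "x' \<in> \<Omega>"
      "\<And>w x''. w \<in> C \<Longrightarrow> x'' \<in> \<Omega> \<Longrightarrow> penalized f z0 (Suc k) z x' \<le> penalized f z0 (Suc k) w x''"
      using penalized_attains_min[OF C \<Omega> cont nonneg _ z0] by metis
    have "\<not> 0 < f (snd z)" using * neg that \<open>1 \<le> real (Suc k)\<close> by blast
    moreover have "penalized f z0 (Suc k) z x' \<le> s\<^sup>2" using *(3)[OF z0] s(2) by metis
    ultimately show ?thesis
      using *(1,2) nonneg[of "snd z"] by (intro exI[of _ z] exI[of _ x']) simp
  qed
  then obtain z x' where zx: "\<And>k. z k \<in> C" "\<And>k. x' k \<in> \<Omega>" "\<And>k. f (snd (z k)) = 0"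
    and sub: "\<And>k. penalized f z0 (Suc k) (z k) (x' k) \<le> s\<^sup>2"
    by metis
  note near = penalized_sublevel[OF nonneg _ sub s(1)]
  have "compact (C \<inter> cball z0 s)" using C by (intro closed_Int_compact) auto
  moreover have "\<forall>k. z k \<in> C \<inter> cball z0 s"
    using zx(1) near(1) by (simp add: dist_norm norm_minus_commute)
  ultimately obtain l \<rho> where l: "l \<in> C \<inter> cball z0 s" and \<rho>: "strict_mono \<rho>"
    and lim: "(z \<circ> \<rho>) \<longlonglongrightarrow> l"
    unfolding compact_def by metis
  \<comment> \<open>The two components of the pair merge in the limit.\<close>
  have gap: "(norm (fst (z k) - x' k))\<^sup>2 \<le> s\<^sup>2 * inverse (real (Suc k))" for k
    using near(3)[of k] by (simp add: field_simps del: of_nat_Suc)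
  have "(\<lambda>k. s\<^sup>2 * inverse (real (Suc k))) \<longlonglongrightarrow> 0"
    using tendsto_mult_right_zero[OF LIMSEQ_inverse_real_of_nat, of "s\<^sup>2"] .
  then have "(\<lambda>k. (norm (fst (z k) - x' k))\<^sup>2) \<longlonglongrightarrow> 0"
    by (rule tendsto_sandwich[OF _ _ tendsto_const, rotated 2]) (simp_all add: gap del: of_nat_Suc)
  then have "(\<lambda>k. sqrt ((norm (fst (z k) - x' k))\<^sup>2)) \<longlonglongrightarrow> sqrt 0"
    by (intro tendsto_intros)
  then have "(\<lambda>k. fst (z k) - x' k) \<longlonglongrightarrow> 0"
    by (simp add: tendsto_norm_zero_iff)
  then have "(\<lambda>k. fst (z (\<rho> k)) - x' (\<rho> k)) \<longlonglongrightarrow> 0"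
    using LIMSEQ_subseq_LIMSEQ[OF _ \<rho>] by (fastforce simp: o_def)
  moreover have zl: "(\<lambda>k. z (\<rho> k)) \<longlonglongrightarrow> l" using lim by (simp add: o_def)
  ultimately have "(\<lambda>k. fst (z (\<rho> k)) - (fst (z (\<rho> k)) - x' (\<rho> k))) \<longlonglongrightarrow> fst l - 0"
    by (intro tendsto_intros)
  then have "(\<lambda>k. x' (\<rho> k)) \<longlonglongrightarrow> fst l" by simp
  then have "fst l \<in> \<Omega>"
    using closed_sequentially[OF \<Omega>, of "\<lambda>k. x' (\<rho> k)"] zx(2) by blast
  then have "0 < f (snd l)" using l pos by blast
  have "(\<lambda>k. f (snd (z (\<rho> k)))) \<longlonglongrightarrow> f (snd l)"
    using continuous_on_tendsto_compose[OF cont tendsto_snd[OF zl]] by simp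
  then have "f (snd l) = 0" by (simp add: zx(3) LIMSEQ_const_iff)
  then show False using \<open>0 < f (snd l)\<close> by simp
qed

text \<open>
  The norm is differentiable away from \<open>0\<close>, with a quadratic upper bound for the remainder. The
  bound is \<open>2 * a * b \<le> a\<^sup>2 + b\<^sup>2\<close> for \<open>a = norm (v + h)\<close> and \<open>b = norm v\<close>.
\<close>

lemma norm_add_le_quadratic:
  fixes v h :: "'a::real_inner"
  assumes "v \<noteq> 0"
  shows "norm (v + h) \<le> norm v + (v /\<^sub>R norm v) \<bullet> h + (norm h)\<^sup>2 / (2 * norm v)"
proof -
  have "0 \<le> (norm (v + h) - norm v)\<^sup>2" by simp
  moreover have "(norm (v + h))\<^sup>2 = (norm v)\<^sup>2 + 2 * (v \<bullet> h) + (norm h)\<^sup>2"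
    by (simp add: power2_norm_eq_inner inner_simps inner_commute)
  ultimately have "2 * (norm (v + h) * norm v) \<le> 2 * (norm v)\<^sup>2 + 2 * (v \<bullet> h) + (norm h)\<^sup>2"
    by (simp add: power2_diff)
  then have "norm (v + h) \<le> (2 * (norm v)\<^sup>2 + 2 * (v \<bullet> h) + (norm h)\<^sup>2) / (2 * norm v)"
    using assms by (simp add: field_simps)
  also have "\<dots> = norm v + (v /\<^sub>R norm v) \<bullet> h + (norm h)\<^sup>2 / (2 * norm v)"
    using assms by (simp add: field_simps power2_eq_square)
  finally show ?thesis .
qed

lemma norm_diff_square_expand:
  fixes u v w :: "'a::real_inner"
  shows "(norm (w - u))\<^sup>2 = (norm (v - u))\<^sup>2 + 2 * ((v - u) \<bullet> (w - v)) + (norm (w - v))\<^sup>2"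
  by (simp add: power2_norm_eq_inner inner_simps inner_commute)

text \<open>
  First order conditions at a minimum. The distance to \<open>Q\<close> is bounded above by the distance to
  the fixed point \<open>q\<close>, with equality at the minimizer, so it may be replaced by the latter, which is
  smooth there. Varying only \<open>x'\<close> gives the normal to \<open>\<Omega>\<close>; varying only \<open>z\<close> gives the normal to \<open>C\<close>.
\<close>

lemma penalized_min_normals:
  fixes C :: "('a::real_inner \<times> 'b::euclidean_space) set"
  assumes j: "0 \<le> j"
    and zx: "z \<in> C" "x' \<in> \<Omega>"
    and min: "\<And>w x''. w \<in> C \<Longrightarrow> x'' \<in> \<Omega> \<Longrightarrow>
      penalized (\<lambda>y. infdist y Q) z0 j z x' \<le> penalized (\<lambda>y. infdist y Q) z0 j w x''"
    and q: "q \<in> Q" "infdist (snd z) Q = norm (snd z - q)" "snd z \<noteq> q"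
  defines "p \<equiv> (2 * j) *\<^sub>R (fst z - x')"
    and "c \<equiv> (snd z - q) /\<^sub>R norm (snd z - q)"
  shows "p \<in> regular_normal_cone \<Omega> x'"
    and "(- p, - c) - 2 *\<^sub>R (z - z0) \<in> regular_normal_cone C z"
proof -
  show "p \<in> regular_normal_cone \<Omega> x'"
  proof (rule regular_normal_coneI_quadratic[where B = j])
    fix x'' assume "x'' \<in> \<Omega>"
    then have "j * (norm (x' - fst z))\<^sup>2 \<le> j * (norm (x'' - fst z))\<^sup>2"
      using min[OF zx(1)] by (simp add: penalized_def norm_minus_commute)
    also have "\<dots> = j * (norm (x' - fst z))\<^sup>2 + j * (2 * ((x' - fst z) \<bullet> (x'' - x')))
        + j * (norm (x'' - x'))\<^sup>2"
      unfolding norm_diff_square_expand[of x'' "fst z" x'] by (simp add: algebra_simps)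
    also have "j * (2 * ((x' - fst z) \<bullet> (x'' - x'))) = - (p \<bullet> (x'' - x'))"
      by (simp add: p_def inner_simps algebra_simps)
    finally show "p \<bullet> (x'' - x') \<le> j * (norm (x'' - x'))\<^sup>2" by simp
  qed
  define D where "D = 1 / (2 * norm (snd z - q))"
  have D: "0 \<le> D" by (simp add: D_def)
  show "(- p, - c) - 2 *\<^sub>R (z - z0) \<in> regular_normal_cone C z"
  proof (rule regular_normal_coneI_quadratic[where B = "D + 1 + j"])
    fix w assume w: "w \<in> C"
    define h where "h = w - z"
    have "norm (snd z - q) + (norm (z - z0))\<^sup>2 + j * (norm (fst z - x'))\<^sup>2
        \<le> infdist (snd w) Q + (norm (w - z0))\<^sup>2 + j * (norm (fst w - x'))\<^sup>2"
      using min[OF w zx(2)] by (simp add: penalized_def q(2))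
    moreover have "infdist (snd w) Q \<le> norm (snd w - q)"
      using infdist_le[OF q(1)] by (simp add: dist_norm)
    moreover have "norm (snd w - q) \<le> norm (snd z - q) + c \<bullet> snd h + D * (norm (snd h))\<^sup>2"
      using norm_add_le_quadratic[of "snd z - q" "snd h"] q(3)
      by (simp add: c_def h_def D_def)
    moreover have "(norm (w - z0))\<^sup>2 = (norm (z - z0))\<^sup>2 + 2 * ((z - z0) \<bullet> h) + (norm h)\<^sup>2"
      unfolding h_def by (rule norm_diff_square_expand)
    moreover have "j * (norm (fst w - x'))\<^sup>2
        = j * (norm (fst z - x'))\<^sup>2 + p \<bullet> fst h + j * (norm (fst h))\<^sup>2"
      unfolding norm_diff_square_expand[of "fst w" x' "fst z"] h_def p_def
      by (simp add: algebra_simps)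
    moreover have "D * (norm (snd h))\<^sup>2 \<le> D * (norm h)\<^sup>2"
      using D by (intro mult_left_mono power_mono) (simp_all add: norm_fst_snd_le)
    moreover have "j * (norm (fst h))\<^sup>2 \<le> j * (norm h)\<^sup>2"
      using j by (intro mult_left_mono power_mono) (simp_all add: norm_fst_snd_le)
    ultimately have "- (p \<bullet> fst h) - c \<bullet> snd h - 2 * ((z - z0) \<bullet> h)
        \<le> D * (norm h)\<^sup>2 + (norm h)\<^sup>2 + j * (norm h)\<^sup>2"
      by linarith
    moreover have "((- p, - c) - 2 *\<^sub>R (z - z0)) \<bullet> h = - (p \<bullet> fst h) - c \<bullet> snd h - 2 * ((z - z0) \<bullet> h)"
      by (simp add: inner_diff_left inner_prod_def)
    ultimately show "((- p, - c) - 2 *\<^sub>R (z - z0)) \<bullet> (w - z) \<le> (D + 1 + j) * (norm (w - z))\<^sup>2"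
      unfolding h_def[symmetric] by (simp add: distrib_right)
  qed
qed

section \<open>Convex cones\<close>

text \<open>
  The set \<open>k + interior K\<close> is open and contained in \<open>K\<close>.
\<close>

lemma convex_cone_add_interior:
  fixes K :: "'a::real_normed_vector set"
  assumes "convex K" and "cone K" and e: "e \<in> interior K" and k: "k \<in> K"
  shows "e + k \<in> interior K"
proof -
  have "(+) k ` interior K \<subseteq> K"
    using assms(1,2) k interior_subset convex_cone[of K] by blast
  then have "(+) k ` interior K \<subseteq> interior K"
    by (intro interior_maximal open_translation) auto
  then show ?thesis using e by (auto simp: add.commute)
qed

lemma cone_scaleR_interior:
  fixes K :: "'a::real_normed_vector set"
  assumes "cone K" and e: "e \<in> interior K" and t: "0 < t"
  shows "t *\<^sub>R e \<in> interior K"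
proof -
  have "(*\<^sub>R) t ` interior K \<subseteq> K"
    using assms(1) t interior_subset unfolding cone_def by fastforce
  then have "(*\<^sub>R) t ` interior K \<subseteq> interior K"
    using t by (intro interior_maximal open_scaling) auto
  then show ?thesis using e by auto
qed

lemma closed_convex_reflection:
  fixes K :: "'a::real_normed_vector set"
  shows "closed K \<Longrightarrow> closed ((\<lambda>k. a - k) ` K)" and "convex K \<Longrightarrow> convex ((\<lambda>k. a - k) ` K)"
proof -
  have eq: "(\<lambda>k. a - k) ` K = (+) a ` uminus ` K"
    by (simp add: image_image)
  show "closed K \<Longrightarrow> closed ((\<lambda>k. a - k) ` K)"
    unfolding eq by (intro closed_translation closed_negations)
  show "convex K \<Longrightarrow> convex ((\<lambda>k. a - k) ` K)"
    unfolding eq by (intro convex_translation convex_negations)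
qed

text \<open>
  The residual of a projection onto \<open>Q\<close> is normal to \<open>Q\<close>, and from any of its points \<open>Q\<close> extends in all
  the directions of \<open>- K\<close>.
\<close>

lemma closest_point_translated_cone_polar:
  fixes K :: "'a::euclidean_space set" and a y :: 'a
  assumes "convex K" and "cone K" and "closed K" and "K \<noteq> {}"
  defines "Q \<equiv> (\<lambda>k. a - k) ` K"
  shows "y - closest_point Q y \<in> positive_polar K"
proof -
  have Q: "convex Q" "closed Q" "Q \<noteq> {}"
    unfolding Q_def using assms(1,3,4) by (simp_all add: closed_convex_reflection)
  obtain k0 where k0: "k0 \<in> K" "closest_point Q y = a - k0"
    using closest_point_in_set[OF Q(2,3), of y] by (auto simp: Q_def)
  show ?thesis unfolding positive_polar_def
  proof safe
    fix k assume "k \<in> K"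
    then have "a - (k0 + k) \<in> Q"
      using assms(1,2) k0(1) convex_cone[of K] unfolding Q_def by blast
    then have "(y - closest_point Q y) \<bullet> (a - (k0 + k) - closest_point Q y) \<le> 0"
      by (rule closest_point_dot[OF Q(1,2)])
    then show "0 \<le> (y - closest_point Q y) \<bullet> k"
      unfolding k0(2) by (simp add: inner_simps)
  qed
qed

section \<open>Approximate multipliers far away\<close>

text \<open>
  The values close to \<open>ybar\<close> that are taken on a bounded part of \<open>\<Omega>\<close> form a compact set, which misses
  \<open>ybar\<close> and hence a neighbourhood of it.
\<close>

lemma far_points_near_unattained_value:
  fixes F :: "'a::euclidean_space \<Rightarrow> 'b::euclidean_space set"
  assumes "closed (gph F)" and "closed \<Omega>"
    and ybar: "ybar \<in> closure (set_valued_image F \<Omega>) - set_valued_image F \<Omega>" and "0 < \<delta>"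
  obtains x y where "x \<in> \<Omega>" and "y \<in> F x" and "R < norm x" and "dist y ybar < \<delta>"
proof -
  let ?B = "gph F \<inter> ((\<Omega> \<inter> cball 0 R) \<times> cball ybar \<delta>)"
  have "compact ?B"
    using assms(1,2) by (intro closed_Int_compact compact_Times) auto
  then have "closed (snd ` ?B)"
    by (intro compact_imp_closed compact_continuous_image continuous_intros)
  moreover have "ybar \<notin> snd ` ?B"
    using ybar by (auto simp: gph_def set_valued_image_def)
  ultimately obtain \<epsilon> where \<epsilon>: "0 < \<epsilon>" "ball ybar \<epsilon> \<subseteq> - snd ` ?B"
    by (meson ComplI open_Compl open_contains_ball)
  obtain y where y: "y \<in> set_valued_image F \<Omega>" "dist y ybar < min \<delta> \<epsilon>"
    using ybar \<epsilon>(1) \<open>0 < \<delta>\<close> closure_approachable[of ybar] by (metis DiffD1 min_less_iff_conj)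
  then obtain x where x: "x \<in> \<Omega>" "y \<in> F x"
    by (auto simp: set_valued_image_def)
  have "R < norm x"
  proof (rule ccontr)
    assume "\<not> R < norm x"
    then have "(x, y) \<in> ?B"
      using x y(2) by (auto simp: gph_def dist_commute)
    then have "y \<in> snd ` ?B" by force
    then show False using \<epsilon>(2) y(2) by (auto simp: dist_commute subset_iff)
  qed
  then show thesis using that x y(2) by auto
qed

text \<open>
  The error \<open>a\<close> is the gradient of the term that keeps the minimizer near its starting point. The
  vector \<open>p\<close> is the same in both normals but is not bounded in terms of \<open>r\<close> and \<open>R\<close>.
\<close>

lemma approximate_multipliers:
  fixes K :: "'b::euclidean_space set" and F :: "'a::euclidean_space \<Rightarrow> 'b set"
  assumes K: "closed K" "convex K" "cone K" "interior K \<noteq> {}"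
    and F: "closed (gph F)" and \<Omega>: "closed \<Omega>"
    and ybar: "ybar \<in> closure (set_valued_image F \<Omega>) - set_valued_image F \<Omega>"
    and weak: "weak_efficient_value K F \<Omega> ybar"
    and r: "0 < r"
  obtains x y x' p c a where "(x, y) \<in> gph F" and "x' \<in> \<Omega>"
    and "R \<le> norm x" and "R \<le> norm x'" and "dist y ybar \<le> r"
    and "p \<in> regular_normal_cone \<Omega> x'"
    and "c \<in> positive_polar K" and "norm c = 1" and "norm a \<le> r"
    and "(- p, - c) + a \<in> regular_normal_cone (gph F) (x, y)"
proof -
  \<comment> \<open>The minimizer will be within \<open>s\<close> of the starting point, \<open>x'\<close> within \<open>s\<close> of \<open>x\<close>, and the
    error is at most \<open>2 * s\<close>.\<close>
  define s where "s = r / 4"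
  have s: "0 < s" "r = 4 * s" using r by (simp_all add: s_def)
  obtain e0 where e0: "e0 \<in> interior K" using K(4) by blast
  \<comment> \<open>The shift is scaled so that half of the budget \<open>s\<^sup>2\<close> for the initial distance to \<open>Q\<close> is left for
    \<open>dist y0 ybar\<close>; the summand \<open>1\<close> avoids division by zero.\<close>
  define e where "e = (s\<^sup>2 / (2 * (norm e0 + 1))) *\<^sub>R e0"
  have pos: "0 < norm e0 + 1" by (simp add: add_nonneg_pos)
  then have e: "e \<in> interior K"
    unfolding e_def using s by (intro cone_scaleR_interior[OF K(3) e0]) simp
  have "s\<^sup>2 * norm e0 \<le> s\<^sup>2 * (norm e0 + 1)" by (intro mult_left_mono) auto
  then have norm_e: "norm e \<le> s\<^sup>2 / 2"
    using pos by (simp add: e_def field_simps)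
  define Q where "Q = (\<lambda>k. (ybar - e) - k) ` K"
  have "e \<in> K" using e interior_subset by blast
  then have "0 *\<^sub>R e \<in> K" using K(3) unfolding cone_def by blast
  then have "0 \<in> K" "K \<noteq> {}" by auto
  then have Q: "closed Q" "Q \<noteq> {}" "ybar - e \<in> Q"
    using K(1) by (auto simp: Q_def closed_convex_reflection intro!: image_eqI[of _ _ 0])
  have avoid: "0 < infdist (snd z) Q" if "z \<in> gph F" "fst z \<in> \<Omega>" for z
  proof -
    have "snd z \<in> set_valued_image F \<Omega>"
      using that by (auto simp: gph_def set_valued_image_def)
    moreover have "Q \<subseteq> (\<lambda>k. ybar - k) ` interior K"
      unfolding Q_def using convex_cone_add_interior[OF K(2,3) e]
      by (auto simp: algebra_simps intro!: image_eqI)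
    ultimately have "snd z \<notin> Q"
      using weak unfolding weak_efficient_value_def by blast
    then show ?thesis
      using in_closed_iff_infdist_zero[OF Q(1,2)] infdist_nonneg[of "snd z" Q] by fastforce
  qed
  obtain x0 y0 where z0: "x0 \<in> \<Omega>" "y0 \<in> F x0" "R + r < norm x0" "dist y0 ybar < min s (s\<^sup>2 / 2)"
    using far_points_near_unattained_value[OF F \<Omega> ybar] s(1)
    by (metis divide_pos_pos min_less_iff_conj zero_less_numeral zero_less_power)
  let ?z0 = "(x0, y0)"
  have z0': "?z0 \<in> gph F" "fst ?z0 \<in> \<Omega>" using z0 by (auto simp: gph_def)
  have "infdist y0 Q \<le> dist y0 (ybar - e)" using Q(3) by (rule infdist_le)
  also have "\<dots> \<le> dist y0 ybar + norm e"
    using norm_triangle_ineq[of "y0 - ybar" e] by (simp add: dist_norm algebra_simps)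
  also have "\<dots> \<le> s\<^sup>2" using z0(4) norm_e by simp
  finally have small: "infdist y0 Q \<le> s\<^sup>2" .
  obtain j z x' where j: "1 \<le> j" and zx: "z \<in> gph F" "x' \<in> \<Omega>" and far: "0 < infdist (snd z) Q"
    and min: "\<And>w x''. w \<in> gph F \<Longrightarrow> x'' \<in> \<Omega> \<Longrightarrow>
      penalized (\<lambda>y. infdist y Q) ?z0 j z x' \<le> penalized (\<lambda>y. infdist y Q) ?z0 j w x''"
    using penalized_min_positive[OF F \<Omega> continuous_on_infdist[OF continuous_on_id] infdist_nonneg z0' avoid]
    by blast
  have "penalized (\<lambda>y. infdist y Q) ?z0 j z x' \<le> s\<^sup>2"
    using min[OF z0'] small by (simp add: penalized_def)
  note near = penalized_sublevel[OF infdist_nonneg j this less_imp_le[OF s(1)]]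
  define q where "q = closest_point Q (snd z)"
  have q: "q \<in> Q" "infdist (snd z) Q = norm (snd z - q)"
    using closest_point_in_set[OF Q(1,2)] setdist_closest_point[OF Q(1,2)]
    by (simp_all add: q_def infdist_eq_setdist flip: dist_norm)
  then have "snd z \<noteq> q" using far by auto
  define p where "p = (2 * j) *\<^sub>R (fst z - x')"
  define c where "c = (snd z - q) /\<^sub>R norm (snd z - q)"
  have normals: "p \<in> regular_normal_cone \<Omega> x'"
      "(- p, - c) - 2 *\<^sub>R (z - ?z0) \<in> regular_normal_cone (gph F) z"
    unfolding p_def c_def
    using penalized_min_normals[OF _ zx min q \<open>snd z \<noteq> q\<close>] j by simp_all
  have nx: "norm (fst z - x0) \<le> s" "norm (snd z - y0) \<le> s"
    using near(1) norm_fst_snd_le[of "z - ?z0"] by simp_all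
  show thesis
  proof
    show "(fst z, snd z) \<in> gph F" "x' \<in> \<Omega>" using zx by simp_all
    show R: "R \<le> norm (fst z)"
      using z0(3) s nx(1) norm_triangle_ineq2[of x0 "fst z"] by (simp add: norm_minus_commute)
    show "R \<le> norm x'"
      using z0(3) s nx(1) near(2) norm_triangle_ineq2[of x0 "fst z"] norm_triangle_ineq2[of "fst z" x']
      by (simp add: norm_minus_commute)
    show "dist (snd z) ybar \<le> r"
      using nx(2) z0(4) s dist_triangle[of "snd z" ybar y0] by (simp add: dist_norm)
    show "p \<in> regular_normal_cone \<Omega> x'" using normals(1) .
    show "norm c = 1" using \<open>snd z \<noteq> q\<close> by (simp add: c_def)
    have "snd z - q \<in> positive_polar K"
      unfolding q_def Q_def using closest_point_translated_cone_polar[OF K(2,3,1) \<open>K \<noteq> {}\<close>] .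
    then show "c \<in> positive_polar K" by (simp add: c_def positive_polar_def)
    show "norm (- (2 *\<^sub>R (z - ?z0))) \<le> r" using near(1) s by simp
    show "(- p, - c) + - (2 *\<^sub>R (z - ?z0)) \<in> regular_normal_cone (gph F) (fst z, snd z)"
      using normals(2) by simp
  qed
qed

section \<open>Passage to the limit\<close>

theorem theorem5p2:
  fixes K :: "(real ^ 'm) set"
    and F :: "real ^ 'n \<Rightarrow> (real ^ 'm) set"
    and \<Omega> :: "(real ^ 'n) set"
    and ybar :: "real ^ 'm"
  assumes "K \<subset> UNIV" and "pointed K" and "closed K" and "convex K" and "cone K"
    and "interior K \<noteq> {}"
    and "closed (gph F)"
    and "closed \<Omega>" and "\<not> bounded \<Omega>"
    and "ybar \<in> closure (set_valued_image F \<Omega>) - set_valued_image F \<Omega>"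
    and "weak_efficient_value K F \<Omega> ybar"
    and "coderivative_at_infinity F ybar 0 \<inter> uminus ` normal_cone_at_infinity \<Omega> = {0}"
  shows "\<exists>cstar \<in> positive_polar K - {0}.
           0 \<in> coderivative_at_infinity F ybar cstar + normal_cone_at_infinity \<Omega>"
proof -
  have "\<exists>x y x' p c a. (x, y) \<in> gph F \<and> x' \<in> \<Omega> \<and> real k \<le> norm x \<and> real k \<le> norm x'
      \<and> dist y ybar \<le> inverse (real (Suc k))
      \<and> p \<in> regular_normal_cone \<Omega> x' \<and> c \<in> positive_polar K \<and> norm c = 1
      \<and> norm a \<le> inverse (real (Suc k))
      \<and> (- p, - c) + a \<in> regular_normal_cone (gph F) (x, y)" for k
    by (rule approximate_multipliers[OF assms(3-8,10,11), of "inverse (real (Suc k))" "real k"])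
      (simp, blast)
  then obtain x y x' p c a where seq: "\<And>k. (x k, y k) \<in> gph F" "\<And>k. x' k \<in> \<Omega>"
      "\<And>k. real k \<le> norm (x k)" "\<And>k. real k \<le> norm (x' k)"
      "\<And>k. dist (y k) ybar \<le> inverse (real (Suc k))"
      "\<And>k. p k \<in> regular_normal_cone \<Omega> (x' k)"
      "\<And>k. c k \<in> positive_polar K" "\<And>k. norm (c k) = 1"
      "\<And>k. norm (a k) \<le> inverse (real (Suc k))"
      "\<And>k. (- p k, - c k) + a k \<in> regular_normal_cone (gph F) (x k, y k)"
    by metis
  have inv0: "(\<lambda>k. inverse (real (Suc k))) \<longlonglongrightarrow> 0" by (rule LIMSEQ_inverse_real_of_nat)
  have ylim: "y \<longlonglongrightarrow> ybar"
    by (rule metric_tendsto_imp_tendsto[OF inv0]) (use seq(5) in auto)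
  have alim: "a \<longlonglongrightarrow> 0"
    by (rule metric_tendsto_imp_tendsto[OF inv0]) (use seq(9) in auto)
  have xlim: "filterlim (\<lambda>k. norm (x k)) at_top sequentially"
    by (rule filterlim_at_top_mono[OF filterlim_real_sequentially]) (simp add: seq(3))
  have x'lim: "filterlim (\<lambda>k. norm (x' k)) at_top sequentially"
    by (rule filterlim_at_top_mono[OF filterlim_real_sequentially]) (simp add: seq(4))
  \<comment> \<open>The factor makes \<open>t p\<close> and \<open>t\<close> bounded with \<open>\<parallel>t p\<parallel> + t = 1\<close>, so that they cannot both
    vanish in the limit.\<close>
  define t where "t k = inverse (1 + norm (p k))" for k
  have t: "0 \<le> t k" "t k \<le> 1" "norm (t k *\<^sub>R p k) + t k = 1" for k
  proof -
    have pos: "0 < 1 + norm (p k)" by (simp add: add_pos_nonneg)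
    then show "0 \<le> t k" "t k \<le> 1" by (simp_all add: t_def field_simps)
    show "norm (t k *\<^sub>R p k) + t k = 1" using pos by (simp add: t_def field_simps)
  qed
  let ?S = "cball (0 :: real^'n) 1 \<times> cball (0 :: real^'m) 1 \<times> cball (0::real) 1"
  have "seq_compact ?S"
    by (intro compact_imp_seq_compact compact_Times compact_cball)
  moreover have "\<forall>k. (t k *\<^sub>R p k, c k, t k) \<in> ?S"
  proof
    fix k
    show "(t k *\<^sub>R p k, c k, t k) \<in> ?S"
      using t(1,2)[of k] t(3)[of k] seq(8)[of k] by (simp del: norm_scaleR)
  qed
  ultimately obtain l \<rho> where \<rho>: "strict_mono \<rho>"
    and lim: "((\<lambda>k. (t k *\<^sub>R p k, c k, t k)) \<circ> \<rho>) \<longlonglongrightarrow> l"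
    by (rule seq_compactE)
  define pl cl tl where "pl = fst l" and "cl = fst (snd l)" and "tl = snd (snd l)"
  have plim: "(\<lambda>k. t (\<rho> k) *\<^sub>R p (\<rho> k)) \<longlonglongrightarrow> pl" and clim: "(\<lambda>k. c (\<rho> k)) \<longlonglongrightarrow> cl"
    and tlim: "(\<lambda>k. t (\<rho> k)) \<longlonglongrightarrow> tl"
    using tendsto_fst[OF lim] tendsto_fst[OF tendsto_snd[OF lim]] tendsto_snd[OF tendsto_snd[OF lim]]
    by (simp_all add: o_def pl_def cl_def tl_def)
  note sub = filterlim_compose[OF _ filterlim_subseq[OF \<rho>]]
  have pl: "pl \<in> normal_cone_at_infinity \<Omega>"
    unfolding normal_cone_at_infinity_def
    using seq(2) sub[OF x'lim] regular_normal_cone_scaleR[OF seq(6) t(1)] plim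
    by (intro CollectI exI[of _ "\<lambda>k. x' (\<rho> k)"] exI[of _ "\<lambda>k. t (\<rho> k) *\<^sub>R p (\<rho> k)"]) auto
  have "(\<lambda>k. (- (t (\<rho> k) *\<^sub>R p (\<rho> k)), - (t (\<rho> k) *\<^sub>R c (\<rho> k))) + t (\<rho> k) *\<^sub>R a (\<rho> k))
      \<longlonglongrightarrow> (- pl, - (tl *\<^sub>R cl)) + tl *\<^sub>R 0"
    by (intro tendsto_intros plim clim tlim sub[OF alim])
  then have nlim: "(\<lambda>k. t (\<rho> k) *\<^sub>R ((- p (\<rho> k), - c (\<rho> k)) + a (\<rho> k))) \<longlonglongrightarrow> (- pl, - (tl *\<^sub>R cl))"
    by (simp add: scaleR_add_right)
  have graph: "(- pl, - (tl *\<^sub>R cl)) \<in> normal_cone_at_infinity_value (gph F) ybar"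
    unfolding normal_cone_at_infinity_value_def
    using seq(1) sub[OF xlim] sub[OF ylim] regular_normal_cone_scaleR[OF seq(10) t(1)] nlim
    by (intro CollectI exI[of _ "\<lambda>k. x (\<rho> k)"] exI[of _ "\<lambda>k. y (\<rho> k)"] exI[of _
        "\<lambda>k. t (\<rho> k) *\<^sub>R ((- p (\<rho> k), - c (\<rho> k)) + a (\<rho> k))"]) auto
  have "(\<lambda>k. norm (t (\<rho> k) *\<^sub>R p (\<rho> k)) + t (\<rho> k)) \<longlonglongrightarrow> norm pl + tl"
    by (intro tendsto_intros plim tlim)
  then have total: "norm pl + tl = 1"
    unfolding t(3) by (simp add: LIMSEQ_const_iff)
  have "tl \<noteq> 0"
  proof
    assume "tl = 0"
    then have "- pl \<in> coderivative_at_infinity F ybar 0 \<inter> uminus ` normal_cone_at_infinity \<Omega>"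
      using graph pl by (simp add: coderivative_at_infinity_def)
    then show False using assms(12) total \<open>tl = 0\<close> by auto
  qed
  moreover have "0 \<le> tl"
    using LIMSEQ_le_const[OF tlim] t(1) by blast
  moreover have "norm cl = 1"
    using tendsto_norm[OF clim] unfolding seq(8) by (simp add: LIMSEQ_const_iff)
  moreover have "cl \<in> positive_polar K"
    unfolding positive_polar_def
  proof safe
    fix k assume "k \<in> K"
    then have "0 \<le> c (\<rho> i) \<bullet> k" for i using seq(7) by (simp add: positive_polar_def)
    then show "0 \<le> cl \<bullet> k"
      using LIMSEQ_le_const[OF tendsto_inner[OF clim tendsto_const]] by blast
  qed
  ultimately have "tl *\<^sub>R cl \<in> positive_polar K - {0}"
    by (auto simp: positive_polar_def)
  moreover have "- pl \<in> coderivative_at_infinity F ybar (tl *\<^sub>R cl)"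
    using graph by (simp add: coderivative_at_infinity_def)
  then have "- pl + pl \<in> coderivative_at_infinity F ybar (tl *\<^sub>R cl) + normal_cone_at_infinity \<Omega>"
    using pl by (rule set_plus_intro)
  ultimately show ?thesis by auto
qed

end
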